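(* Let $\mathcal{X}$ be a complex separable Hilbert space, $(\Omega,\mu)$ a measure space with positive measure $\mu$, and let $(\Xi,\Phi)$, with $\Xi,\Phi:\Omega\to\mathcal{X}$, be a continuous biframe for $\mathcal{X}$ with bounds $C$ and $D$. Then: (i) the biframe operator $\mathcal{T}_{\Xi,\Phi}$ is bounded, positive and invertible. (ii) For a pair $(\Xi,\Phi)$ of maps $\Omega\to\mathcal{X}$, $(\Xi,\Phi)$ is a continuous biframe for $\mathcal{X}$ if and only if $(\Phi,\Xi)$ is a continuous biframe for $\mathcal{X}$.
   Context: Inner products are linear in the first variable. A pair $(\Xi,\Phi)$ of maps $\Omega\to\mathcal{X}$, $\omega\mapsto\Xi_\omega,\Phi_\omega$, is a continuous biframe for $\mathcal{X}$ (with respect to $(\Omega,\mu)$) if both are weakly measurable (i.e. $\omega\mapsto\langle\xi,\Xi_\omega\rangle$ and $\omega\mapsto\langle\xi,\Phi_\omega\rangle$ are measurable for every $\xi\in\mathcal{X}$) and there are constants $C,D>0$ (the lower and upper biframe bounds) with $C\|\xi\|^2\le\int_\Omega\langle\xi,\Xi_\omega\rangle\langle\Phi_\omega,\xi\rangle\,d\mu(\omega)\le D\|\xi\|^2$ for all $\xi\in\mathcal{X}$ (in particular the integral exists and is real). Its biframe operator is $\mathcal{T}_{\Xi,\Phi}\xi=\int_\Omega\langle\xi,\Xi_\omega\rangle\Phi_\omega\,d\mu(\omega)$, understood in the weak sense: $\langle\mathcal{T}_{\Xi,\Phi}\xi,\eta\rangle=\int_\Omega\langle\xi,\Xi_\omega\rangle\langle\Phi_\omega,\eta\rangle\,d\mu(\omega)$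 for all $\xi,\eta\in\mathcal{X}$. *)

theory Defs
  imports "HOL-Analysis.Analysis"
begin

text \<open>
  The inner product is linear in its first argument and conjugate-linear in the second. The real
  structure inherited from \<open>real_normed_vector\<close> is tied to the complex one by \<open>scaleR_scaleC\<close>.
\<close>

class complex_inner = real_normed_vector +
  fixes scaleC :: "complex \<Rightarrow> 'a \<Rightarrow> 'a" (infixr "*\<^sub>C" 75)
    and cinner :: "'a \<Rightarrow> 'a \<Rightarrow> complex"
  assumes scaleC_add_right: "c *\<^sub>C (x + y) = c *\<^sub>C x + c *\<^sub>C y"
    and scaleC_add_left: "(c + d) *\<^sub>C x = c *\<^sub>C x + d *\<^sub>C x"
    and scaleC_scaleC: "c *\<^sub>C (d *\<^sub>C x) = (c * d) *\<^sub>C x"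
    and scaleR_scaleC: "r *\<^sub>R x = complex_of_real r *\<^sub>C x"
    and cinner_commute: "cinner x y = cnj (cinner y x)"
    and cinner_add_left: "cinner (x + y) z = cinner x z + cinner y z"
    and cinner_scaleC_left: "cinner (c *\<^sub>C x) y = c * cinner x y"
    and cinner_self_nonneg: "0 \<le> Re (cinner x x)"
    and cinner_self_eq_0_iff: "cinner x x = 0 \<longleftrightarrow> x = 0"
    and norm_eq_sqrt_cinner: "norm x = sqrt (Re (cinner x x))"

class complex_hilbert = complex_inner + complete_space

definition bounded_clinear :: "('a::complex_inner \<Rightarrow> 'b::complex_inner) \<Rightarrow> bool" where
  "bounded_clinear T \<longleftrightarrow> bounded_linear T \<and> (\<forall>c x. T (c *\<^sub>C x) = c *\<^sub>C T x)"

definition positive_operator :: "('a::complex_inner \<Rightarrow> 'a) \<Rightarrow> bool" where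
  "positive_operator T \<longleftrightarrow> (\<forall>x. cinner (T x) x \<in> \<real>\<^sub>\<ge>\<^sub>0)"

text \<open>Invertibility is in the algebra of bounded operators: the inverse is bounded too.\<close>

definition invertible_operator :: "('a::complex_inner \<Rightarrow> 'a) \<Rightarrow> bool" where
  "invertible_operator T \<longleftrightarrow> (\<exists>S. bounded_clinear S \<and> S \<circ> T = id \<and> T \<circ> S = id)"

definition weakly_measurable :: "'b measure \<Rightarrow> ('b \<Rightarrow> 'a::complex_inner) \<Rightarrow> bool" where
  "weakly_measurable M F \<longleftrightarrow> (\<forall>\<xi>. (\<lambda>\<omega>. cinner \<xi> (F \<omega>)) \<in> borel_measurable M)"

text \<open>
  The parameter set is \<open>space M\<close>; values of the maps outside it are irrelevant. Existence and
  realness of the integral are stated explicitly, because the library integral of a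
  non-integrable function is 0.
\<close>

definition continuous_biframe_bounds ::
    "'b measure \<Rightarrow> ('b \<Rightarrow> 'a::complex_inner) \<Rightarrow> ('b \<Rightarrow> 'a) \<Rightarrow> real \<Rightarrow> real \<Rightarrow> bool" where
  "continuous_biframe_bounds M \<Xi> \<Phi> C D \<longleftrightarrow>
     weakly_measurable M \<Xi> \<and> weakly_measurable M \<Phi> \<and> C > 0 \<and> D > 0 \<and>
     (\<forall>\<xi>. integrable M (\<lambda>\<omega>. cinner \<xi> (\<Xi> \<omega>) * cinner (\<Phi> \<omega>) \<xi>) \<and>
          (LINT \<omega>|M. cinner \<xi> (\<Xi> \<omega>) * cinner (\<Phi> \<omega>) \<xi>) \<in> \<real> \<and>
          C * (norm \<xi>)\<^sup>2 \<le> Re (LINT \<omega>|M. cinner \<xi> (\<Xi> \<omega>) * cinner (\<Phi> \<omega>) \<xi>) \<and>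
          Re (LINT \<omega>|M. cinner \<xi> (\<Xi> \<omega>) * cinner (\<Phi> \<omega>) \<xi>) \<le> D * (norm \<xi>)\<^sup>2)"

definition continuous_biframe ::
    "'b measure \<Rightarrow> ('b \<Rightarrow> 'a::complex_inner) \<Rightarrow> ('b \<Rightarrow> 'a) \<Rightarrow> bool" where
  "continuous_biframe M \<Xi> \<Phi> \<longleftrightarrow> (\<exists>C D. continuous_biframe_bounds M \<Xi> \<Phi> C D)"

text \<open>\<open>T \<xi>\<close> is the weak integral of \<open>cinner \<xi> (\<Xi> \<omega>) *\<^sub>C \<Phi> \<omega>\<close>.\<close>

definition is_biframe_operator ::
    "'b measure \<Rightarrow> ('b \<Rightarrow> 'a::complex_inner) \<Rightarrow> ('b \<Rightarrow> 'a) \<Rightarrow> ('a \<Rightarrow> 'a) \<Rightarrow> bool" where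
  "is_biframe_operator M \<Xi> \<Phi> T \<longleftrightarrow>
     (\<forall>\<xi> \<eta>. integrable M (\<lambda>\<omega>. cinner \<xi> (\<Xi> \<omega>) * cinner (\<Phi> \<omega>) \<eta>) \<and>
            cinner (T \<xi>) \<eta> = (LINT \<omega>|M. cinner \<xi> (\<Xi> \<omega>) * cinner (\<Phi> \<omega>) \<eta>))"

lemma is_biframe_operator_unique:
  assumes "is_biframe_operator M \<Xi> \<Phi> S" and "is_biframe_operator M \<Xi> \<Phi> T"
  shows "S = T"
proof
  fix \<xi>
  have eq: "cinner (S \<xi>) \<eta> = cinner (T \<xi>) \<eta>" for \<eta>
    using assms by (simp add: is_biframe_operator_def)
  have "cinner (S \<xi> - T \<xi> + T \<xi>) \<eta> = cinner (S \<xi> - T \<xi>) \<eta> + cinner (T \<xi>) \<eta>" for \<eta>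
    by (rule cinner_add_left)
  then have "cinner (S \<xi> - T \<xi>) \<eta> = 0" for \<eta>
    using eq by simp
  then show "S \<xi> = T \<xi>"
    using cinner_self_eq_0_iff [of "S \<xi> - T \<xi>"] by simp
qed

definition biframe_operator ::
    "'b measure \<Rightarrow> ('b \<Rightarrow> 'a::complex_inner) \<Rightarrow> ('b \<Rightarrow> 'a) \<Rightarrow> 'a \<Rightarrow> 'a" where
  "biframe_operator M \<Xi> \<Phi> = (THE T. is_biframe_operator M \<Xi> \<Phi> T)"

end

theory Submission
  imports Defs
begin

text \<open>
  By polarization, the integrability and the bounds on the diagonal make
  \<open>B \<xi> \<eta> = (LINT \<omega>|M. cinner \<xi> (\<Xi> \<omega>) * cinner (\<Phi> \<omega>) \<eta>)\<close> a Hermitian form whose quadratic form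
  is equivalent to the squared norm. Riesz representation therefore applies to \<open>cinner\<close> and
  to \<open>B\<close> alike: representing \<open>B\<close> by \<open>cinner\<close> yields the biframe operator, and representing
  \<open>cinner\<close> by \<open>B\<close> yields its inverse. Exchanging \<open>\<Xi>\<close> and \<open>\<Phi>\<close> conjugates the integrand on the
  diagonal, whose integral is real.
\<close>

section \<open>Real Riesz representation by minimization\<close>

text \<open>First-order condition: the polynomial has its minimum 0 at \<open>t = 0\<close>, where
  its derivative is \<open>2 * b\<close>.\<close>

lemma nonneg_quadratic_imp_linear_coeff_0:
  fixes a b :: real
  assumes "\<And>t. 0 \<le> t\<^sup>2 * a + 2 * t * b"
  shows "b = 0"
proof (rule ccontr)
  assume "b \<noteq> 0"
  define s where "s = \<bar>a\<bar> + 1"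
  have s: "s > 0" "a < s" "s \<noteq> 0" by (auto simp: s_def)
  have "(- b / s)\<^sup>2 * a + 2 * (- b / s) * b = (b / s)\<^sup>2 * (a - 2 * s)"
    using s by (simp add: field_simps power2_eq_square)
  moreover have "(b / s)\<^sup>2 * (a - 2 * s) < 0"
    using \<open>b \<noteq> 0\<close> s by (intro mult_pos_neg) auto
  ultimately show False using assms[of "- b / s"] by simp
qed

text \<open>The representing vector minimizes \<open>\<lambda>x. A x x - 2 * f x\<close>.\<close>

lemma symmetric_coercive_representation:
  fixes A :: "'a::{real_normed_vector,complete_space} \<Rightarrow> 'a \<Rightarrow> real"
  assumes A: "bounded_bilinear A" and sym: "\<And>x y. A x y = A y x"
    and c: "c > 0" and coercive: "\<And>x. c * (norm x)\<^sup>2 \<le> A x x"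
    and f: "bounded_linear f"
  shows "\<exists>x. \<forall>y. A x y = f y"
proof -
  interpret A: bounded_bilinear A by (rule A)
  interpret f: bounded_linear f by (rule f)
  define J where "J x = A x x - 2 * f x" for x
  define m where "m = Inf (range J)"
  obtain K where K: "\<And>x. norm (f x) \<le> norm x * K"
    using f.bounded by blast
  have "- (K\<^sup>2 / c) \<le> J x" for x
  proof -
    \<comment> \<open>Completing the square in the lower bound
      \<open>c * (norm x)\<^sup>2 - 2 * (norm x * K)\<close> for \<open>J x\<close>.\<close>
    have "0 \<le> (c * norm x - K)\<^sup>2 / c" using c by simp
    also have "\<dots> = c * (norm x)\<^sup>2 - 2 * (norm x * K) + K\<^sup>2 / c"
      using c by (simp add: field_simps power2_eq_square)
    finally show ?thesis using K[of x] coercive[of x] by (simp add: J_def)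
  qed
  then have bdd: "bdd_below (range J)" by (auto intro!: bdd_belowI)
  then have m: "m \<le> J x" for x by (auto simp: m_def intro: cInf_lower)
  have "\<exists>x. J x < m + inverse (real (Suc n))" for n
    using cInf_lessD[of "range J" "m + inverse (real (Suc n))"]
    by (auto simp: m_def)
  then obtain X where X: "\<And>n. J (X n) < m + inverse (real (Suc n))" by metis
  \<comment> \<open>Parallelogram identity; the contributions of \<open>f\<close> cancel. As
    \<open>J\<close> is at least \<open>m\<close> at the midpoint, near-minimizers lie close
    together.\<close>
  have par: "A (x - y) (x - y) = 2 * J x + 2 * J y - 4 * J ((1/2) *\<^sub>R (x + y))" for x y
    by (simp add: J_def A.add_left A.add_right A.diff_left A.diff_right A.scaleR_left
        A.scaleR_right f.add f.scaleR algebra_simps sym[of y x])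
  have "Cauchy X"
  proof (rule metric_CauchyI)
    fix e :: real assume e: "e > 0"
    \<comment> \<open>In \<open>par\<close>, two values below \<open>m + c * e\<^sup>2 / 4\<close>
      against the midpoint value, at least \<open>m\<close>, leave less than
      \<open>c * e\<^sup>2\<close>.\<close>
    obtain N where N: "inverse (real (Suc N)) < c * e\<^sup>2 / 4"
      using reals_Archimedean[of "c * e\<^sup>2 / 4"] c e by auto
    have "dist (X i) (X j) < e" if "i \<ge> N" "j \<ge> N" for i j
    proof -
      have J: "J (X k) < m + c * e\<^sup>2 / 4" if "k \<ge> N" for k
      proof -
        have "inverse (real (Suc k)) \<le> inverse (real (Suc N))"
          using that by (intro le_imp_inverse_le) auto
        then show ?thesis using X[of k] N by linarith
      qed
      have "c * (norm (X i - X j))\<^sup>2 \<le> A (X i - X j) (X i - X j)" by (rule coercive)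
      also have "\<dots> < c * e\<^sup>2"
        using J[OF that(1)] J[OF that(2)] m[of "(1/2) *\<^sub>R (X i + X j)"]
        unfolding par by linarith
      finally have "(norm (X i - X j))\<^sup>2 < e\<^sup>2" using c by simp
      then show ?thesis using e by (simp add: dist_norm power2_less_imp_less)
    qed
    then show "\<exists>N. \<forall>i\<ge>N. \<forall>j\<ge>N. dist (X i) (X j) < e" by blast
  qed
  then obtain x where x: "X \<longlonglongrightarrow> x"
    using Cauchy_convergent convergent_def by blast
  have "(\<lambda>n. J (X n)) \<longlonglongrightarrow> J x"
    unfolding J_def by (intro tendsto_intros A.tendsto f.tendsto x)
  moreover have "(\<lambda>n. m + inverse (real (Suc n))) \<longlonglongrightarrow> m"
    using tendsto_add[OF tendsto_const LIMSEQ_inverse_real_of_nat, of m] by simp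
  ultimately have "J x \<le> m"
    by (rule LIMSEQ_le) (use X less_imp_le in blast)
  then have min: "J x \<le> J z" for z using m[of z] by linarith
  have "A x y = f y" for y
  proof -
    \<comment> \<open>The right-hand side is \<open>J (x + t *\<^sub>R y) - J x\<close>.\<close>
    have "0 \<le> t\<^sup>2 * A y y + 2 * t * (A x y - f y)" for t
      using min[of "x + t *\<^sub>R y"]
      by (simp add: J_def A.add_left A.add_right A.scaleR_left A.scaleR_right f.add f.scaleR
          power2_eq_square algebra_simps sym[of y x])
    then show ?thesis using nonneg_quadratic_imp_linear_coeff_0 by fastforce
  qed
  then show ?thesis by blast
qed

section \<open>Coercive Hermitian forms and their representing operators\<close>

locale coercive_form =
  fixes h :: "'a::complex_inner \<Rightarrow> 'a \<Rightarrow> complex" and c d :: real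
  assumes add_left: "h (x + y) z = h x z + h y z"
    and add_right: "h x (y + z) = h x y + h x z"
    and scale_left: "h (k *\<^sub>C x) y = k * h x y"
    and scale_right: "h x (k *\<^sub>C y) = cnj k * h x y"
    and diag_real: "Im (h x x) = 0"
    and pos: "c > 0"
    and lower: "c * (norm x)\<^sup>2 \<le> Re (h x x)"
    and upper: "Re (h x x) \<le> d * (norm x)\<^sup>2"
begin

text \<open>Polarization of the real diagonal: \<open>x + y\<close> compares the imaginary parts,
  \<open>x + \<i> *\<^sub>C y\<close> the real parts.\<close>

lemma commute: "h x y = cnj (h y x)"
proof (rule complex_eqI)
  show "Im (h x y) = Im (cnj (h y x))"
    using diag_real[of "x + y"] diag_real[of x] diag_real[of y]
    by (simp add: add_left add_right)
  show "Re (h x y) = Re (cnj (h y x))"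
    using diag_real[of "x + \<i> *\<^sub>C y"] diag_real[of x] diag_real[of y]
    by (simp add: add_left add_right scale_left scale_right)
qed

lemma Re_sym: "Re (h x y) = Re (h y x)"
  by (metis commute cnj.sel(1))

lemma scaleR_left: "h (r *\<^sub>R x) y = r * h x y"
  by (simp add: scaleR_scaleC scale_left)

lemma scaleR_right: "h x (r *\<^sub>R y) = r * h x y"
  by (simp add: scaleR_scaleC scale_right)

lemma diff_left: "h (x - y) z = h x z - h y z"
  using add_left[of "x - y" y z] by simp

lemma diag_nonneg: "0 \<le> Re (h x x)"
  using pos lower[of x] by (meson mult_nonneg_nonneg less_imp_le order_trans zero_le_power2)

lemma eq_0: "h x x = 0 \<Longrightarrow> x = 0"
  using pos lower[of x] by (simp add: mult_le_0_iff)

lemma Cauchy_Schwarz: "(Re (h x y))\<^sup>2 \<le> Re (h x x) * Re (h y y)"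
proof (cases "y = 0")
  case True
  then show ?thesis using add_right[of y 0 0] add_right[of x 0 0] by simp
next
  case False
  define p where "p = Re (h y y)"
  define b where "b = Re (h x y)"
  have "0 < c * (norm y)\<^sup>2" using False pos by simp
  then have p: "p > 0" using lower[of y] by (simp add: p_def)
  \<comment> \<open>This vector is \<open>p\<close> times the component of \<open>x\<close>
    orthogonal to \<open>y\<close> for the real form \<open>Re (h x y)\<close>.\<close>
  have "0 \<le> Re (h (p *\<^sub>R x + (- b) *\<^sub>R y) (p *\<^sub>R x + (- b) *\<^sub>R y))" by (rule diag_nonneg)
  also have "\<dots> = p * (p * Re (h x x) - b\<^sup>2)"
    unfolding add_left add_right scaleR_left scaleR_right
    using Re_sym[of y x] by (simp add: p_def b_def power2_eq_square algebra_simps)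
  finally show ?thesis using p by (simp add: zero_le_mult_iff p_def b_def mult.commute)
qed

text \<open>Cauchy-Schwarz carries the diagonal bound \<open>upper\<close> over to all pairs, which
  makes the real part a bounded bilinear form.\<close>

lemma Re_bounded: "\<bar>Re (h x y)\<bar> \<le> d * norm x * norm y"
proof -
  \<comment> \<open>A nonzero \<open>x\<close> forces \<open>d \<ge> 0\<close> through the diagonal;
    for \<open>x = 0\<close> the product below vanishes.\<close>
  have "d \<ge> 0 \<or> x = 0"
    using order_trans[OF diag_nonneg upper, of x] by (auto simp: zero_le_mult_iff)
  then have "0 \<le> d * norm x * norm y" by auto
  moreover have "(Re (h x y))\<^sup>2 \<le> (d * (norm x)\<^sup>2) * (d * (norm y)\<^sup>2)"
    by (rule order_trans[OF Cauchy_Schwarz mult_mono[OF upper upper]])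
       (rule order_trans[OF diag_nonneg upper] diag_nonneg)+
  moreover have "(d * (norm x)\<^sup>2) * (d * (norm y)\<^sup>2) = (d * norm x * norm y)\<^sup>2"
    by (simp add: power2_eq_square)
  ultimately show ?thesis
    by (metis power2_abs power2_le_imp_le)
qed

lemma bounded_bilinear_Re: "bounded_bilinear (\<lambda>x y. Re (h x y))"
proof
  show "\<exists>K. \<forall>x y. norm (Re (h x y)) \<le> norm x * norm y * K"
    using Re_bounded by (auto simp: mult_ac intro!: exI[of _ d])
qed (simp_all add: add_left add_right scaleR_left scaleR_right)

end

lemma coercive_form_cinner: "coercive_form (cinner :: 'a::complex_inner \<Rightarrow> _) 1 1"
proof
  fix x y z :: 'a and k
  have comm: "cinner x y = cnj (cinner y x)" for x y :: 'a by (rule cinner_commute)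
  show "cinner (x + y) z = cinner x z + cinner y z" by (rule cinner_add_left)
  show "cinner (k *\<^sub>C x) y = k * cinner x y" by (rule cinner_scaleC_left)
  show "cinner x (y + z) = cinner x y + cinner x z"
    by (metis comm cinner_add_left complex_cnj_add)
  show "cinner x (k *\<^sub>C y) = cnj k * cinner x y"
    by (metis comm cinner_scaleC_left complex_cnj_mult)
  show "Im (cinner x x) = 0"
    using arg_cong[OF comm[of x x], of Im] by simp
  have "(norm x)\<^sup>2 = Re (cinner x x)"
    by (simp add: norm_eq_sqrt_cinner cinner_self_nonneg)
  then show "1 * (norm x)\<^sup>2 \<le> Re (cinner x x)" "Re (cinner x x) \<le> 1 * (norm x)\<^sup>2"
    by simp_all
qed simp

text \<open>For fixed \<open>x\<close>, the real part of \<open>g x\<close> is a bounded real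
  functional, which the real part of \<open>h\<close> represents by a vector, taken as
  \<open>T x\<close>.\<close>

lemma coercive_form_representation:
  fixes h g :: "'a::complex_hilbert \<Rightarrow> 'a \<Rightarrow> complex"
  assumes "coercive_form h c d" "coercive_form g c' d'"
  shows "\<exists>T. bounded_clinear T \<and> (\<forall>x y. h (T x) y = g x y)"
proof -
  interpret h: coercive_form h c d by fact
  interpret g: coercive_form g c' d' by fact
  have "\<exists>z. \<forall>y. h z y = g x y" for x
  proof -
    obtain z where z: "\<And>y. Re (h z y) = Re (g x y)"
      using symmetric_coercive_representation[OF h.bounded_bilinear_Re h.Re_sym h.pos h.lower
          bounded_bilinear.bounded_linear_right[OF g.bounded_bilinear_Re]] by metis
    \<comment> \<open>Conjugate-linearity in the second argument makes the real part at
      \<open>\<i> *\<^sub>C y\<close> the imaginary part at \<open>y\<close>.\<close>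
    have "h z y = g x y" for y
      using z[of y] z[of "\<i> *\<^sub>C y"]
      by (simp add: h.scale_right g.scale_right complex_eq_iff)
    then show ?thesis by blast
  qed
  then obtain T where T: "\<And>x y. h (T x) y = g x y" by metis
  \<comment> \<open>\<open>h\<close> is nondegenerate, so linearity of \<open>T\<close> can be
    tested inside \<open>h\<close>, where it becomes linearity of \<open>g\<close>.\<close>
  have uniq: "u = v" if "\<And>y. h u y = h v y" for u v
    using h.eq_0[of "u - v"] that by (simp add: h.diff_left)
  have scaleC: "T (k *\<^sub>C x) = k *\<^sub>C T x" for k x
    by (rule uniq) (simp add: T g.scale_left h.scale_left)
  have "bounded_linear T"
  proof (rule bounded_linear_intro)
    show "T (x + y) = T x + T y" for x y
      by (rule uniq) (simp add: T g.add_left h.add_left)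
    show "T (r *\<^sub>R x) = r *\<^sub>R T x" for r x
      by (simp add: scaleR_scaleC scaleC)
    show "norm (T x) \<le> norm x * (\<bar>d'\<bar> / c)" for x
    proof (cases "T x = 0")
      case False
      \<comment> \<open>Coercivity of \<open>h\<close> at \<open>T x\<close> meets the bound of
        \<open>g\<close>; one factor \<open>norm (T x)\<close> then cancels.\<close>
      have "c * (norm (T x))\<^sup>2 \<le> Re (g x (T x))" using h.lower[of "T x"] by (simp add: T)
      also have "\<dots> \<le> d' * norm x * norm (T x)" using g.Re_bounded[of x "T x"] by linarith
      also have "\<dots> \<le> \<bar>d'\<bar> * norm x * norm (T x)" by (intro mult_right_mono) auto
      finally have "c * norm (T x) \<le> \<bar>d'\<bar> * norm x"
        using False by (simp add: power2_eq_square)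
      then show ?thesis using h.pos by (simp add: field_simps)
    qed (use h.pos in simp)
  qed
  then show ?thesis using T scaleC by (auto simp: bounded_clinear_def)
qed

section \<open>The form of a biframe and its operator\<close>

lemma continuous_biframe_bounds_swap:
  assumes "continuous_biframe_bounds M \<Xi> \<Phi> C D"
  shows "continuous_biframe_bounds M \<Phi> \<Xi> C D"
proof -
  have "cinner \<xi> (\<Phi> \<omega>) * cinner (\<Xi> \<omega>) \<xi> = cnj (cinner \<xi> (\<Xi> \<omega>) * cinner (\<Phi> \<omega>) \<xi>)" for \<xi> \<omega>
    by (simp add: cinner_commute[symmetric] mult.commute)
  then show ?thesis
    using assms unfolding continuous_biframe_bounds_def
    \<comment> \<open>The conjugate must stay outside the product to be pulled out of the
      integral.\<close>
    by (simp add: Reals_cnj_iff del: complex_cnj_mult)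
qed

lemma coercive_form_continuous_biframe:
  fixes \<Xi> \<Phi> :: "'b \<Rightarrow> 'a::complex_inner"
  assumes "continuous_biframe_bounds M \<Xi> \<Phi> C D"
  defines "b \<equiv> \<lambda>\<xi> \<eta> \<omega>. cinner \<xi> (\<Xi> \<omega>) * cinner (\<Phi> \<omega>) \<eta>"
  shows "integrable M (b \<xi> \<eta>)" and "coercive_form (\<lambda>\<xi> \<eta>. LINT \<omega>|M. b \<xi> \<eta> \<omega>) C D"
proof -
  interpret cinner: coercive_form "cinner :: 'a \<Rightarrow> _" 1 1 by (rule coercive_form_cinner)
  have diag: "integrable M (b \<xi> \<xi>)" for \<xi>
    using assms by (simp add: continuous_biframe_bounds_def)
  have int: "integrable M (b \<xi> \<eta>)" for \<xi> \<eta>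
  proof -
    define p where "p k = b (\<xi> + k *\<^sub>C \<eta>) (\<xi> + k *\<^sub>C \<eta>)" for k
    \<comment> \<open>Polarization pointwise in \<open>\<omega>\<close>: four integrable diagonal
      integrands give the mixed one.\<close>
    have "b \<xi> \<eta> = (\<lambda>\<omega>. (p 1 \<omega> - p (-1) \<omega> + \<i> * p \<i> \<omega> - \<i> * p (-\<i>) \<omega>) / 4)"
      by (rule ext) (simp add: p_def b_def cinner.add_left cinner.add_right cinner.scale_left
          cinner.scale_right field_simps)
    then show ?thesis using diag by (simp add: p_def)
  qed
  then show "integrable M (b \<xi> \<eta>)" .
  show "coercive_form (\<lambda>\<xi> \<eta>. LINT \<omega>|M. b \<xi> \<eta> \<omega>) C D"
  proof
    fix x y z :: 'a and k
    show "(LINT \<omega>|M. b (x + y) z \<omega>) = (LINT \<omega>|M. b x z \<omega>) + (LINT \<omega>|M. b y z \<omega>)"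
      using Bochner_Integration.integral_add[OF int int, of x z y z]
      by (simp add: b_def cinner.add_left distrib_right)
    show "(LINT \<omega>|M. b x (y + z) \<omega>) = (LINT \<omega>|M. b x y \<omega>) + (LINT \<omega>|M. b x z \<omega>)"
      using Bochner_Integration.integral_add[OF int int, of x y x z]
      by (simp add: b_def cinner.add_right distrib_left)
    show "(LINT \<omega>|M. b (k *\<^sub>C x) y \<omega>) = k * (LINT \<omega>|M. b x y \<omega>)"
      using integral_mult_right_zero[of M k "b x y"]
      by (simp add: b_def cinner.scale_left mult.assoc)
    show "(LINT \<omega>|M. b x (k *\<^sub>C y) \<omega>) = cnj k * (LINT \<omega>|M. b x y \<omega>)"
      using integral_mult_right_zero[of M "cnj k" "b x y"]
      by (simp add: b_def cinner.scale_right mult.left_commute)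
  qed (use assms in \<open>auto simp: continuous_biframe_bounds_def complex_is_Real_iff\<close>)
qed

text \<open>Lets the properties of a constructed operator pass to the one defined by
  description.\<close>

lemma biframe_operator_eqI:
  "is_biframe_operator M \<Xi> \<Phi> T \<Longrightarrow> biframe_operator M \<Xi> \<Phi> = T"
  unfolding biframe_operator_def by (blast intro: is_biframe_operator_unique)

theorem theorem3p5:
  fixes M :: "'b measure"
    and \<Xi> \<Phi> :: "'b \<Rightarrow> 'a::complex_hilbert"
    and C D :: real
  assumes "separable_space (euclidean :: 'a topology)"
  shows "(continuous_biframe_bounds M \<Xi> \<Phi> C D \<longrightarrow>
            is_biframe_operator M \<Xi> \<Phi> (biframe_operator M \<Xi> \<Phi>) \<and>
            bounded_clinear (biframe_operator M \<Xi> \<Phi>) \<and>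
            positive_operator (biframe_operator M \<Xi> \<Phi>) \<and>
            invertible_operator (biframe_operator M \<Xi> \<Phi>)) \<and>
         (continuous_biframe M \<Xi> \<Phi> \<longleftrightarrow> continuous_biframe M \<Phi> \<Xi>)"
proof (intro conjI impI)
  show "continuous_biframe M \<Xi> \<Phi> \<longleftrightarrow> continuous_biframe M \<Phi> \<Xi>"
    using continuous_biframe_bounds_swap unfolding continuous_biframe_def by blast
next
  assume bf: "continuous_biframe_bounds M \<Xi> \<Phi> C D"
  define B where "B \<xi> \<eta> = (LINT \<omega>|M. cinner \<xi> (\<Xi> \<omega>) * cinner (\<Phi> \<omega>) \<eta>)" for \<xi> \<eta>
  interpret B: coercive_form B C D
    unfolding B_def by (rule coercive_form_continuous_biframe(2)[OF bf])
  interpret cinner: coercive_form "cinner :: 'a \<Rightarrow> _" 1 1 by (rule coercive_form_cinner)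
  obtain T where T: "bounded_clinear T" "\<And>\<xi> \<eta>. cinner (T \<xi>) \<eta> = B \<xi> \<eta>"
    using coercive_form_representation[OF cinner.coercive_form_axioms B.coercive_form_axioms]
    by blast
  obtain S where S: "bounded_clinear S" "\<And>\<xi> \<eta>. B (S \<xi>) \<eta> = cinner \<xi> \<eta>"
    using coercive_form_representation[OF B.coercive_form_axioms cinner.coercive_form_axioms]
    by blast
  have "is_biframe_operator M \<Xi> \<Phi> T"
    using coercive_form_continuous_biframe(1)[OF bf] T(2)
    by (simp add: is_biframe_operator_def B_def)
  moreover have "positive_operator T"
    using B.diag_nonneg B.diag_real
    by (simp add: positive_operator_def T(2) complex_nonneg_Reals_iff)
  moreover have "invertible_operator T"
  proof -
    \<comment> \<open>\<open>cinner (T (S \<xi>)) \<eta> = B (S \<xi>) \<eta> = cinner \<xi>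
      \<eta>\<close>. The other composition is tested in \<open>B\<close> instead.\<close>
    have "T (S \<xi>) = \<xi>" for \<xi>
      using cinner.eq_0[of "T (S \<xi>) - \<xi>"] by (simp add: cinner.diff_left T S)
    moreover have "S (T \<xi>) = \<xi>" for \<xi>
      using B.eq_0[of "S (T \<xi>) - \<xi>"] by (simp add: B.diff_left T S)
    ultimately show ?thesis
      using S(1) by (auto simp: invertible_operator_def fun_eq_iff)
  qed
  ultimately show "is_biframe_operator M \<Xi> \<Phi> (biframe_operator M \<Xi> \<Phi>)"
    "bounded_clinear (biframe_operator M \<Xi> \<Phi>)"
    "positive_operator (biframe_operator M \<Xi> \<Phi>)"
    "invertible_operator (biframe_operator M \<Xi> \<Phi>)"
    using T(1) by (simp_all add: biframe_operator_eqI)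
qed

end
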